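(* Let $G$ be a connected non-transmission regular graph of order $n$, and let $\alpha\in[0,1)$. Let $Tr_{max}$ denote the maximum vertex transmission of $G$ and $\mu_\alpha(G)$ the $D_\alpha$ spectral radius of $G$. (1) If $n$ is odd, then $$Tr_{max}-\mu_{\alpha}(G)\ge\frac{(1-\alpha)n+1-\sqrt{[(1-\alpha)n+1]^2-4(1-\alpha)}}{2},$$ with equality if and only if $G\cong K_{1,2,2,\ldots,2}$, the complete multipartite graph on $n$ vertices whose parts all have two vertices except one part which has a single vertex. (2) If $n$ is even, then $$Tr_{max}-\mu_{\alpha}(G)\ge\frac{(1-\alpha)n+2-\sqrt{[(1-\alpha)n+2]^2-8(1-\alpha)}}{2},$$ with equality if and only if $G$ is an $(n-4)$-DVDR graph.
   Context: All graphs are simple and connected. For vertices $v_i,v_j$, $d_{ij}$ is the distance between them; the transmission of $v_i$ is $Tr_i=\sum_{k=1}^n d_{ik}$, and $Tr_{max}$ is the maximum transmission over all vertices. $G$ is transmission regular if all vertices have equal transmission, and non-transmission regular otherwise. $D(G)=(d_{ij})$ is the distance matrix, $Tr(G)=\mathrm{diag}(Tr_1,\ldots,Tr_n)$, and for $\alpha\in[0,1]$ the generalized distance matrix is $D_\alpha(G)=\alpha Tr(G)+(1-\alpha)D(G)$; its largest eigenvalue is $\mu_\alpha(G)$. A connected graph $G$ of order $n$ is a distinguished vertex deleted regular (DVDR) graph if it has a vertex $v$ of degree $n-1$ such that $G-v$ is regular; it is an $r$-DVDR graph if $G-v$ is $r$-regular. *)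

theory Defs
  imports
    "Graph_Theory.Graph_Theory"
    "Jordan_Normal_Form.Spectral_Radius"
begin

text \<open>
  A simple graph is a symmetric, loop-free digraph without parallel arcs on a finite vertex set
  (locale \<^locale>\<open>graph\<close> of the Graph-Theory entry): every edge is a pair of opposite arcs, so
  the degree of a vertex is its out-degree.
\<close>

text \<open>The real-valued distance is meaningful for connected graphs only.\<close>

definition gdist :: "('a, 'b) pre_digraph \<Rightarrow> 'a \<Rightarrow> 'a \<Rightarrow> real" where
  "gdist G u v = real_of_ereal (wf_digraph.\<mu> G (\<lambda>_. 1) u v)"

definition transmission :: "('a, 'b) pre_digraph \<Rightarrow> 'a \<Rightarrow> real" where
  "transmission G u = (\<Sum>v\<in>verts G. gdist G u v)"

definition max_transmission :: "('a, 'b) pre_digraph \<Rightarrow> real" where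
  "max_transmission G = Max (transmission G ` verts G)"

definition transmission_regular :: "('a, 'b) pre_digraph \<Rightarrow> bool" where
  "transmission_regular G \<longleftrightarrow>
     (\<forall>u\<in>verts G. \<forall>v\<in>verts G. transmission G u = transmission G v)"

text \<open>The list \<open>vs\<close> is an enumeration \<open>v\<^sub>1, \<dots>, v\<^sub>n\<close> of the vertices; it indexes rows and columns.\<close>

definition distance_matrix :: "('a, 'b) pre_digraph \<Rightarrow> 'a list \<Rightarrow> real mat" where
  "distance_matrix G vs = Matrix.mat (length vs) (length vs) (\<lambda>(i, j). gdist G (vs ! i) (vs ! j))"

definition transmission_matrix :: "('a, 'b) pre_digraph \<Rightarrow> 'a list \<Rightarrow> real mat" where
  "transmission_matrix G vs = mat_diag (length vs) (\<lambda>i. transmission G (vs ! i))"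

definition gen_distance_matrix :: "real \<Rightarrow> ('a, 'b) pre_digraph \<Rightarrow> 'a list \<Rightarrow> real mat" where
  "gen_distance_matrix \<alpha> G vs =
     \<alpha> \<cdot>\<^sub>m transmission_matrix G vs + (1 - \<alpha>) \<cdot>\<^sub>m distance_matrix G vs"

text \<open>
  The spectrum of a real matrix consists of its real eigenvalues; generalized distance matrices
  of graphs are symmetric, so these are all the eigenvalues.
\<close>

definition D_spectral_radius :: "real \<Rightarrow> ('a, 'b) pre_digraph \<Rightarrow> 'a list \<Rightarrow> real" where
  "D_spectral_radius \<alpha> G vs = Max (spectrum (gen_distance_matrix \<alpha> G vs))"

definition regular_graph :: "nat \<Rightarrow> ('a, 'b) pre_digraph \<Rightarrow> bool" where
  "regular_graph r G \<longleftrightarrow> (\<forall>u\<in>verts G. out_degree G u = r)"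

definition DVDR :: "nat \<Rightarrow> ('a, 'b) pre_digraph \<Rightarrow> bool" where
  "DVDR r G \<longleftrightarrow> graph G \<and> Digraph_Component.connected G \<and>
     (\<exists>v\<in>verts G. out_degree G v = card (verts G) - 1 \<and>
                  regular_graph r (pre_digraph.del_vert G v))"

text \<open>
  The complete multipartite graph whose parts have the sizes listed in \<open>ps\<close>;
  the vertex \<open>(i, k)\<close> is the \<open>k\<close>-th vertex of the \<open>i\<close>-th part.
\<close>

definition complete_multipartite ::
    "nat list \<Rightarrow> (nat \<times> nat, (nat \<times> nat) \<times> (nat \<times> nat)) pre_digraph" where
  "complete_multipartite ps = (let V = (SIGMA i:{..<length ps}. {..<ps ! i}) in
     with_proj \<lparr>pverts = V, parcs = {(x, y). x \<in> V \<and> y \<in> V \<and> fst x \<noteq> fst y}\<rparr>)"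

end

theory Submission
  imports Defs
begin

text \<open>
  Let \<open>\<beta> = 1 - \<alpha>\<close>, let \<open>x\<close> be an eigenvector for the spectral radius \<open>\<mu>\<close>, and let \<open>t\<^sub>u\<close> be the
  difference between the maximum transmission and the transmission of \<open>u\<close>. Then
  \<open>(Tr\<^sub>m\<^sub>a\<^sub>x - \<mu>) \<bar>x\<bar>\<^sup>2 = \<Sum>\<^sub>u t\<^sub>u x\<^sub>u\<^sup>2 + \<beta>/2 \<Sum>\<^sub>u\<^sub>w d\<^sub>u\<^sub>w (x\<^sub>u - x\<^sub>w)\<^sup>2\<close>.
  Replacing every distance by 1 and \<open>t\<close> by \<open>c \<le> t\<^sub>v\<close> at a single vertex \<open>v\<close> bounds this from below by an
  explicit quadratic form with least eigenvalue \<open>gap\<close>. Its eigenvector is constant off \<open>v\<close> with a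
  different value at \<open>v\<close>, so equality forces \<open>v\<close> to be adjacent to all vertices and every other
  vertex to have exactly \<open>c\<close> non-neighbours. One may take \<open>c = 1\<close>. For even order the sum of \<open>t\<close> is
  even, so either \<open>c = 2\<close> works or \<open>t\<close> is at least 1 at two vertices, which is strictly better.
\<close>

section \<open>Real eigenvalues of symmetric matrices\<close>

text \<open>For a complex eigenvector \<open>z\<close> with eigenvalue \<open>k\<close>, symmetry
  makes the Hermitian form \<open>R\<close> of \<open>A\<close> at \<open>z\<close> equal to its own
  conjugate. As \<open>R\<close> is \<open>k\<close> times a positive number, \<open>k\<close> is
  real and hence a root of the real characteristic polynomial. This keeps the \<open>Max\<close> in
  \<open>D_spectral_radius\<close> from ranging over an empty set.\<close>

lemma real_symmetric_spectrum_nonempty: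
  fixes A :: "real mat"
  assumes A: "A \<in> carrier_mat n n" and "n \<noteq> 0"
    and sym: "\<And>i j. i < n \<Longrightarrow> j < n \<Longrightarrow> A $$ (i, j) = A $$ (j, i)"
  shows "spectrum A \<noteq> {}"
proof -
  define C where "C = map_mat complex_of_real A"
  have C: "C \<in> carrier_mat n n" using A by (simp add: C_def)
  obtain k where k: "k \<in> spectrum C" using spectrum_non_empty[OF C] \<open>n \<noteq> 0\<close> by auto
  then obtain z where z: "z \<in> carrier_vec n" "z \<noteq> 0\<^sub>v n" and Cz: "C *\<^sub>v z = k \<cdot>\<^sub>v z"
    using C by (auto simp: spectrum_def eigenvalue_def eigenvector_def)
  have row: "(\<Sum>j<n. complex_of_real (A $$ (i, j)) * z $ j) = k * z $ i" if "i < n" for i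
  proof -
    have "(C *\<^sub>v z) $ i = k * z $ i" using that z by (simp add: Cz)
    then show ?thesis using that A z
      by (simp add: C_def scalar_prod_def atLeast0LessThan)
  qed
  define N where "N = (\<Sum>i<n. (cmod (z $ i))\<^sup>2)"
  define R where "R = (\<Sum>i<n. \<Sum>j<n. complex_of_real (A $$ (i, j)) * (cnj (z $ i) * z $ j))"
  have R: "R = k * complex_of_real N"
  proof -
    have "R = (\<Sum>i<n. cnj (z $ i) * (\<Sum>j<n. complex_of_real (A $$ (i, j)) * z $ j))"
      by (simp add: R_def sum_distrib_left mult_ac)
    also have "\<dots> = (\<Sum>i<n. k * complex_of_real ((cmod (z $ i))\<^sup>2))"
      unfolding complex_norm_square by (intro sum.cong refl) (simp add: row)
    finally show ?thesis by (simp add: N_def sum_distrib_left)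
  qed
  have "cnj R = (\<Sum>i<n. \<Sum>j<n. complex_of_real (A $$ (i, j)) * (z $ i * cnj (z $ j)))"
    by (simp add: R_def)
  also have "\<dots> = (\<Sum>j<n. \<Sum>i<n. complex_of_real (A $$ (i, j)) * (z $ i * cnj (z $ j)))"
    by (rule sum.swap)
  also have "\<dots> = R"
    unfolding R_def by (intro sum.cong refl) (simp add: sym mult_ac)
  finally have RR: "cnj R = R" .
  have "N > 0"
  proof -
    obtain i where "i < n" "z $ i \<noteq> 0" using z by (auto simp: vec_eq_iff)
    then show ?thesis unfolding N_def by (intro sum_pos2[of _ i]) auto
  qed
  with RR R have "cnj k = k" by simp
  then obtain r where r: "k = complex_of_real r" by (metis Reals_cases Reals_cnj_iff)
  have "poly (char_poly C) k = 0" using k spectrum_root_char_poly[OF C] by simp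
  then have "poly (char_poly A) r = 0"
    unfolding C_def r by (simp add: of_real_hom.char_poly_hom[OF A])
  then show ?thesis using spectrum_root_char_poly[OF A] by auto
qed

section \<open>The number \<open>gap\<close> and lower bounds for the energy form\<close>

text \<open>
  The smaller root of \<open>l\<^sup>2 - (\<beta> n + c) l + c \<beta>\<close>, which is the least eigenvalue of \<open>c E + \<beta> (n I - J)\<close>
  where \<open>E\<close> has a single nonzero entry, a 1 on the diagonal, and \<open>J\<close> is the all-ones matrix.
\<close>

definition gap :: "real \<Rightarrow> real \<Rightarrow> real \<Rightarrow> real" where
  "gap \<beta> n c = (\<beta> * n + c - sqrt ((\<beta> * n + c)\<^sup>2 - 4 * c * \<beta>)) / 2"

text \<open>The strict bounds come from the discriminant, which exceeds
  \<open>(\<beta> * n + c - 2 * \<beta>)\<^sup>2\<close> by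
  \<open>4 * \<beta>\<^sup>2 * (n - 1)\<close> and \<open>(\<beta> * n - c)\<^sup>2\<close> by
  \<open>4 * c * \<beta> * (n - 1)\<close>. They later keep the coefficients of the squares positive
  and the eigenvector non-constant.\<close>

lemma gap_quadratic:
  assumes "0 < \<beta>" "0 < c" "1 < n"
  shows "(gap \<beta> n c)\<^sup>2 - (\<beta> * n + c) * gap \<beta> n c + c * \<beta> = 0"
    and "gap \<beta> n c < \<beta>" and "gap \<beta> n c < c"
proof -
  define D where "D = (\<beta> * n + c)\<^sup>2 - 4 * c * \<beta>"
  have D1: "(\<beta> * n + c - 2 * \<beta>)\<^sup>2 < D" "(\<beta> * n - c)\<^sup>2 < D"
    using assms by (auto simp: D_def power2_eq_square algebra_simps)
  then have "D \<ge> 0" by (meson less_imp_le order_trans zero_le_power2)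
  have g: "gap \<beta> n c = (\<beta> * n + c - sqrt D) / 2" by (simp add: gap_def D_def)
  have "(sqrt D)\<^sup>2 = D" using \<open>D \<ge> 0\<close> by simp
  then show "(gap \<beta> n c)\<^sup>2 - (\<beta> * n + c) * gap \<beta> n c + c * \<beta> = 0"
    unfolding g by (simp add: D_def power2_eq_square field_simps)
  show "gap \<beta> n c < \<beta>" "gap \<beta> n c < c"
    using D1[THEN real_less_rsqrt] by (auto simp: g)
qed

text \<open>For symmetric \<open>d\<close> this is the quadratic form of the diagonal matrix of
  \<open>t\<close> plus \<open>\<beta>\<close> times the Laplacian of the weights \<open>d\<close>.
  The factor 1/2 compensates for summing over ordered pairs.\<close>

definition energy :: "'a set \<Rightarrow> real \<Rightarrow> ('a \<Rightarrow> real) \<Rightarrow> ('a \<Rightarrow> 'a \<Rightarrow> real) \<Rightarrow> ('a \<Rightarrow> real) \<Rightarrow> real" where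
  "energy V \<beta> t d x =
     (\<Sum>u\<in>V. t u * (x u)\<^sup>2) + \<beta> / 2 * (\<Sum>u\<in>V. \<Sum>w\<in>V. d u w * (x u - x w)\<^sup>2)"

lemma sum_square_differences:
  fixes x :: "'a \<Rightarrow> real"
  assumes "finite V"
  shows "(\<Sum>u\<in>V. \<Sum>w\<in>V. (x u - x w)\<^sup>2) = 2 * (card V * (\<Sum>u\<in>V. (x u)\<^sup>2) - (\<Sum>u\<in>V. x u)\<^sup>2)"
proof -
  have "(\<Sum>u\<in>V. \<Sum>w\<in>V. (x u - x w)\<^sup>2)
      = (\<Sum>u\<in>V. \<Sum>w\<in>V. (x u)\<^sup>2) + (\<Sum>u\<in>V. \<Sum>w\<in>V. (x w)\<^sup>2) - 2 * (\<Sum>u\<in>V. \<Sum>w\<in>V. x u * x w)"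
    by (simp add: power2_diff sum.distrib sum_subtractf sum_distrib_left mult_ac)
  also have "\<dots> = 2 * (card V * (\<Sum>u\<in>V. (x u)\<^sup>2) - (\<Sum>u\<in>V. x u)\<^sup>2)"
    by (simp add: power2_eq_square sum_product sum_distrib_left[symmetric])
  finally show ?thesis .
qed

text \<open>Completing squares: the last two summands vanish exactly on the eigenvectors for \<open>gap\<close>.\<close>

lemma energy_complete_graph:
  fixes x :: "'a \<Rightarrow> real"
  assumes V: "finite V" "v \<in> V" "2 \<le> card V" and "0 < \<beta>" "0 < c"
  defines "l \<equiv> gap \<beta> (card V) c" and "m \<equiv> real (card V) - 1"
    and "S \<equiv> \<Sum>u\<in>V - {v}. x u"
  shows "c * (x v)\<^sup>2 + \<beta> / 2 * (\<Sum>u\<in>V. \<Sum>w\<in>V. (x u - x w)\<^sup>2)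
    = l * (\<Sum>u\<in>V. (x u)\<^sup>2) + (c + \<beta> * m - l) * (x v - \<beta> * S / (c + \<beta> * m - l))\<^sup>2
      + (\<beta> * card V - l) * (\<Sum>u\<in>V - {v}. (x u - S / m)\<^sup>2)"
proof -
  define a P Q where "a = x v" and "P = c + \<beta> * m - l" and "Q = (\<Sum>u\<in>V - {v}. (x u)\<^sup>2)"
  have m: "m \<ge> 1" "real (card V) = m + 1" "real (card (V - {v})) = m"
    using V by (auto simp: m_def)
  have l: "l\<^sup>2 - (\<beta> * (m + 1) + c) * l + c * \<beta> = 0" "l < \<beta>" "l < c"
    using gap_quadratic[of \<beta> c "real (card V)"] \<open>0 < \<beta>\<close> \<open>0 < c\<close> m(1,2) by (simp_all add: l_def)
  have P: "P > 0" using l m \<open>0 < \<beta>\<close> unfolding P_def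
    by (smt (verit) mult_nonneg_nonneg)
  \<comment> \<open>The quadratic equation for \<open>l\<close>, read as a vanishing determinant:
    the form minus \<open>l\<close> times the squared norm is degenerate on vectors that are
    constant off \<open>v\<close>. It makes the two terms
    \<open>(\<beta> - l) * S\<^sup>2 / m\<close> below cancel.\<close>
  have key: "\<beta>\<^sup>2 * m = (\<beta> - l) * P"
    using l(1) by (simp add: P_def power2_eq_square algebra_simps)
  have sq: "(\<Sum>u\<in>V. (x u)\<^sup>2) = a\<^sup>2 + Q" and s: "(\<Sum>u\<in>V. x u) = a + S"
    by (simp_all add: a_def Q_def S_def sum.remove[OF V(1,2)])
  have q: "(\<Sum>u\<in>V - {v}. (x u - S / m)\<^sup>2) = Q - S\<^sup>2 / m"
  proof -
    have "(\<Sum>u\<in>V - {v}. (x u - k)\<^sup>2) = Q + m * k\<^sup>2 - 2 * k * S" for k :: real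
      using m(3) by (simp add: power2_diff sum.distrib sum_subtractf Q_def S_def sum_distrib_left mult_ac)
    then show ?thesis using m(1) by (simp only:) (simp add: power2_eq_square field_simps)
  qed
  have "P * (a - \<beta> * S / P)\<^sup>2 = P * a\<^sup>2 - 2 * a * \<beta> * S + \<beta>\<^sup>2 * S\<^sup>2 / P"
    using P by (simp add: power2_eq_square field_simps)
  also have "\<beta>\<^sup>2 * S\<^sup>2 / P = (\<beta> - l) * S\<^sup>2 / m"
  proof -
    have "\<beta>\<^sup>2 / P = (\<beta> - l) / m" using key P m(1) by (simp add: field_simps)
    then show ?thesis by (metis times_divide_eq_left)
  qed
  finally have 1: "P * (a - \<beta> * S / P)\<^sup>2 = P * a\<^sup>2 - 2 * a * \<beta> * S + (\<beta> - l) * S\<^sup>2 / m" .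
  have 2: "(\<beta> * (m + 1) - l) * (Q - S\<^sup>2 / m) = (\<beta> * (m + 1) - l) * Q - \<beta> * S\<^sup>2 - (\<beta> - l) * S\<^sup>2 / m"
    using m(1) by (simp add: field_simps)
  show ?thesis
    unfolding sum_square_differences[OF V(1)] sq s q m(2) a_def[symmetric] P_def[symmetric] 1 2
    by (simp add: P_def power2_eq_square algebra_simps)
qed

text \<open>The energy exceeds \<open>l\<close> times the squared norm by nonnegative terms: the two
  squares \<open>A1\<close>, \<open>A2\<close> of \<open>energy_complete_graph\<close>, the excess
  \<open>A3\<close> of \<open>t v\<close> over \<open>c\<close>, the weights \<open>A4\<close> off
  \<open>v\<close>, and a multiple of the excess \<open>A5\<close> of \<open>d\<close> over 1. In
  the equality case all of them vanish. Then \<open>A1\<close> and \<open>A2\<close> determine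
  \<open>x\<close> up to scaling; as \<open>x\<close> is nowhere zero and differs at
  \<open>v\<close>, the other three determine \<open>t\<close> and the distances to
  \<open>v\<close>.\<close>

lemma energy_bound:
  fixes x :: "'a \<Rightarrow> real"
  assumes V: "finite V" "v \<in> V" "2 \<le> card V" and "0 < \<beta>" "0 < c"
    and t: "c \<le> t v" "\<And>u. u \<in> V - {v} \<Longrightarrow> 0 \<le> t u"
    and d: "\<And>u w. u \<in> V \<Longrightarrow> w \<in> V \<Longrightarrow> u \<noteq> w \<Longrightarrow> 1 \<le> d u w"
  shows energy_ge: "gap \<beta> (card V) c * (\<Sum>u\<in>V. (x u)\<^sup>2) \<le> energy V \<beta> t d x"
    and energy_eqD: "\<lbrakk>energy V \<beta> t d x = gap \<beta> (card V) c * (\<Sum>u\<in>V. (x u)\<^sup>2); \<exists>u\<in>V. x u \<noteq> 0\<rbrakk> \<Longrightarrow>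
      t v = c \<and> (\<forall>u\<in>V - {v}. t u = 0 \<and> d u v = 1) \<and> (\<exists>b. x v \<noteq> b \<and> (\<forall>u\<in>V - {v}. x u = b))"
proof -
  define l m S P where "l = gap \<beta> (card V) c" and "m = real (card V) - 1"
    and "S = (\<Sum>u\<in>V - {v}. x u)" and "P = c + \<beta> * m - l"
  define A1 where "A1 = P * (x v - \<beta> * S / P)\<^sup>2"
  define A2 where "A2 = (\<beta> * card V - l) * (\<Sum>u\<in>V - {v}. (x u - S / m)\<^sup>2)"
  define A3 where "A3 = (t v - c) * (x v)\<^sup>2"
  define A4 where "A4 = (\<Sum>u\<in>V - {v}. t u * (x u)\<^sup>2)"
  define A5 where "A5 = (\<Sum>u\<in>V. \<Sum>w\<in>V. (d u w - 1) * (x u - x w)\<^sup>2)"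
  have m: "m \<ge> 1" "real (card V) = m + 1" using V by (auto simp: m_def)
  have l: "l\<^sup>2 - (\<beta> * (m + 1) + c) * l + c * \<beta> = 0" "l < \<beta>" "l < c"
    using gap_quadratic[of \<beta> c "real (card V)"] \<open>0 < \<beta>\<close> \<open>0 < c\<close> m(1,2) by (simp_all add: l_def)
  have P: "P > 0" using l m \<open>0 < \<beta>\<close> unfolding P_def by (smt (verit) mult_nonneg_nonneg)
  have pos: "\<beta> * card V - l > 0" using l m \<open>0 < \<beta>\<close>
    by (smt (verit, best) mult_le_cancel_left1)
  have terms: "(d u w - 1) * (x u - x w)\<^sup>2 \<ge> 0" if "u \<in> V" "w \<in> V" for u w
    using d[OF that] by (cases "u = w") auto
  have nn: "0 \<le> A1" "0 \<le> A2" "0 \<le> A3" "0 \<le> A4" "0 \<le> A5"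
    unfolding A1_def A2_def A3_def A4_def A5_def
    using P pos t by (intro mult_nonneg_nonneg sum_nonneg terms; simp)+
  have "energy V \<beta> t d x = c * (x v)\<^sup>2 + \<beta> / 2 * (\<Sum>u\<in>V. \<Sum>w\<in>V. (x u - x w)\<^sup>2) + A3 + A4 + \<beta> / 2 * A5"
    unfolding energy_def A3_def A4_def A5_def sum.remove[OF V(1,2), of "\<lambda>u. t u * (x u)\<^sup>2"]
    by (simp add: algebra_simps sum_subtractf)
  then have eq: "energy V \<beta> t d x = l * (\<Sum>u\<in>V. (x u)\<^sup>2) + A1 + A2 + A3 + A4 + \<beta> / 2 * A5"
    unfolding energy_complete_graph[OF assms(1-5)] A1_def A2_def P_def S_def m_def l_def by simp
  have nn5: "0 \<le> \<beta> / 2 * A5" using nn \<open>0 < \<beta>\<close> by simp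
  then show "gap \<beta> (card V) c * (\<Sum>u\<in>V. (x u)\<^sup>2) \<le> energy V \<beta> t d x"
    using eq nn by (simp add: l_def)
  assume eq0: "energy V \<beta> t d x = gap \<beta> (card V) c * (\<Sum>u\<in>V. (x u)\<^sup>2)" and nz: "\<exists>u\<in>V. x u \<noteq> 0"
  have "A1 + A2 + A3 + A4 + \<beta> / 2 * A5 = 0" using eq eq0 by (simp add: l_def)
  then have z: "A1 = 0" "A2 = 0" "A3 = 0" "A4 = 0" "A5 = 0"
    using nn nn5 \<open>0 < \<beta>\<close> by (auto simp: add_nonneg_eq_0_iff)
  define b where "b = S / m"
  have xv: "x v = \<beta> * m * b / P" using z(1) P m by (simp add: A1_def b_def)
  have xu: "x u = b" if "u \<in> V - {v}" for u
    using z(2) pos that V by (auto simp: A2_def b_def sum_nonneg_eq_0_iff)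
  have "b \<noteq> 0"
  proof
    assume "b = 0"
    then have "x u = 0" if "u \<in> V" for u using xv xu[of u] that by (cases "u = v") auto
    then show False using nz by auto
  qed
  then have xv0: "x v \<noteq> 0" using xv P m \<open>0 < \<beta>\<close> by simp
  \<comment> \<open>Equal values would give \<open>P = \<beta> * m\<close>, that is
    \<open>l = c\<close>, contrary to \<open>l < c\<close>.\<close>
  have xvb: "x v \<noteq> b"
  proof
    assume "x v = b"
    then have "\<beta> * m = P" using xv \<open>b \<noteq> 0\<close> P by (simp add: field_simps)
    then show False using l by (simp add: P_def)
  qed
  have "t v = c" using z(3) xv0 by (simp add: A3_def)
  moreover have "t u = 0" if "u \<in> V - {v}" for u
  proof -
    have "t u * (x u)\<^sup>2 = 0" using z(4) that V t(2) unfolding A4_def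
      by (subst (asm) sum_nonneg_eq_0_iff) auto
    then show ?thesis using xu[OF that] \<open>b \<noteq> 0\<close> by simp
  qed
  \<comment> \<open>Only pairs containing \<open>v\<close> give information, since \<open>x\<close>
    is constant on the others.\<close>
  moreover have "d u v = 1" if "u \<in> V - {v}" for u
  proof -
    have "(\<Sum>w\<in>V. (d u w - 1) * (x u - x w)\<^sup>2) = 0" using z(5) that V terms unfolding A5_def
      by (subst (asm) sum_nonneg_eq_0_iff) (auto intro!: sum_nonneg)
    then have "(d u v - 1) * (x u - x v)\<^sup>2 = 0" using that V terms
      by (subst (asm) sum_nonneg_eq_0_iff) auto
    then show ?thesis using xu[OF that] xvb by simp
  qed
  ultimately show "t v = c \<and> (\<forall>u\<in>V - {v}. t u = 0 \<and> d u v = 1) \<and>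
      (\<exists>b. x v \<noteq> b \<and> (\<forall>u\<in>V - {v}. x u = b))"
    using xu xvb by blast
qed

text \<open>The weight \<open>t\<close> is the mean of two weights, each carrying at least 2 on one of \<open>u\<close>, \<open>v\<close>.\<close>

lemma energy_two_vertices:
  fixes x :: "'a \<Rightarrow> real"
  assumes V: "finite V" "u \<in> V" "v \<in> V" "u \<noteq> v" "3 \<le> card V" and "0 < \<beta>"
    and t: "1 \<le> t u" "1 \<le> t v" "\<And>w. w \<in> V \<Longrightarrow> 0 \<le> t w"
    and d: "\<And>u w. u \<in> V \<Longrightarrow> w \<in> V \<Longrightarrow> u \<noteq> w \<Longrightarrow> 1 \<le> d u w"
    and nz: "\<exists>u\<in>V. x u \<noteq> 0"
  shows "gap \<beta> (card V) 2 * (\<Sum>u\<in>V. (x u)\<^sup>2) < energy V \<beta> t d x"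
proof -
  define t1 where "t1 w = t w + of_bool (w = u) - of_bool (w = v)" for w
  define t2 where "t2 w = t w + of_bool (w = v) - of_bool (w = u)" for w
  let ?L = "gap \<beta> (card V) 2 * (\<Sum>u\<in>V. (x u)\<^sup>2)"
  have mean: "energy V \<beta> t d x = (energy V \<beta> t1 d x + energy V \<beta> t2 d x) / 2"
  proof -
    have "(\<Sum>w\<in>V. t1 w * (x w)\<^sup>2) + (\<Sum>w\<in>V. t2 w * (x w)\<^sup>2) = 2 * (\<Sum>w\<in>V. t w * (x w)\<^sup>2)"
      by (simp add: t1_def t2_def sum.distrib[symmetric] sum_distrib_left algebra_simps)
    then show ?thesis by (simp add: energy_def field_simps)
  qed
  have t1: "2 \<le> t1 u" "\<And>w. w \<in> V - {u} \<Longrightarrow> 0 \<le> t1 w"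
    and t2: "2 \<le> t2 v" "\<And>w. w \<in> V - {v} \<Longrightarrow> 0 \<le> t2 w"
    using t V by (auto simp: t1_def t2_def of_bool_def)
  have b1: "?L \<le> energy V \<beta> t1 d x" using energy_ge[of V u \<beta> 2 t1 d x] V \<open>0 < \<beta>\<close> t1 d by simp
  have b2: "?L \<le> energy V \<beta> t2 d x" using energy_ge[of V v \<beta> 2 t2 d x] V \<open>0 < \<beta>\<close> t2 d by simp
  have "\<not> (energy V \<beta> t1 d x = ?L \<and> energy V \<beta> t2 d x = ?L)"
  proof
    \<comment> \<open>Equality twice makes \<open>x\<close> constant off \<open>u\<close> and
      constant off \<open>v\<close>. A third vertex identifies the two constants, so
      \<open>x u\<close> equals the value off \<open>u\<close>, which the equality case
      excludes.\<close>
    assume eq: "energy V \<beta> t1 d x = ?L \<and> energy V \<beta> t2 d x = ?L"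
    obtain b1 where b1: "x u \<noteq> b1" "\<forall>w\<in>V - {u}. x w = b1"
      using energy_eqD[of V u \<beta> 2 t1 d x] V \<open>0 < \<beta>\<close> t1 d nz eq by auto
    obtain b2 where b2: "x v \<noteq> b2" "\<forall>w\<in>V - {v}. x w = b2"
      using energy_eqD[of V v \<beta> 2 t2 d x] V \<open>0 < \<beta>\<close> t2 d nz eq by auto
    have "\<not> V \<subseteq> {u, v}" using card_mono[of "{u, v}" V] V by auto
    then obtain w where "w \<in> V" "w \<noteq> u" "w \<noteq> v" by auto
    then show False using b1 b2 V by (metis DiffI singletonD)
  qed
  then have "?L < energy V \<beta> t1 d x \<or> ?L < energy V \<beta> t2 d x" using b1 b2 by auto
  then show ?thesis using mean b1 b2 by (elim disjE) simp_all
qed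

section \<open>Distances and transmissions in a connected graph\<close>

locale connected_graph = graph +
  assumes connected: "Digraph_Component.connected G"
begin

lemma adj_sym: "u \<rightarrow> w \<Longrightarrow> w \<rightarrow> u"
  using arcs_ends_symmetric[OF sym_arcs] .

lemma adj_commute: "u \<rightarrow> w \<longleftrightarrow> w \<rightarrow> u"
  using adj_sym by blast

text \<open>An edge is a pair of opposite arcs, so the reversed walk consists of the opposite arcs.
  This is what makes the distance symmetric.\<close>

lemma awalk_rev:
  "awalk u p v \<Longrightarrow> \<exists>q. awalk v q u \<and> length q = length p"
proof (induction p arbitrary: u)
  case Nil
  then show ?case by (auto simp: awalk_Nil_iff)
next
  case (Cons e p)
  then have e: "e \<in> arcs G" "u = tail G e" and "awalk (head G e) p v"
    by (auto simp: awalk_Cons_iff)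
  with Cons.IH obtain q where q: "awalk v q (head G e)" "length q = length p" by blast
  have "head G e \<rightarrow> u" using e adj_sym[of u "head G e"] by (auto simp: arcs_ends_conv)
  then obtain e' where "e' \<in> arcs G" "tail G e' = head G e" "head G e' = u" by auto
  then have "awalk (head G e) [e'] u" using arc_implies_awalk by fastforce
  with q(1) have "awalk v (q @ [e']) u" by (rule awalk_appendI)
  then show ?case using q(2) by (intro exI[of _ "q @ [e']"]) simp
qed

text \<open>\<open>\<mu>\<close> is an infimum of extended real walk costs. Connectedness supplies a
  walk, so a shortest one exists and attains the infimum. The distance is therefore a natural
  number, and the later facts on \<open>gdist\<close> rest on this.\<close>

lemma gdist_awalk:
  assumes "u \<in> verts G" "v \<in> verts G"
  obtains p where "awalk u p v" "gdist G u v = real (length p)"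
    "\<And>q. awalk u q v \<Longrightarrow> length p \<le> length q"
proof -
  have "u \<rightarrow>\<^sup>* v"
    using connected assms reachable_mk_symmetric_eq[OF sym_arcs]
    by (auto simp: connected_def strongly_connected_def)
  then obtain p0 where "awalk u p0 v" by (auto simp: reachable_awalk)
  then obtain p where p: "awalk u p v" "\<And>q. awalk u q v \<Longrightarrow> length p \<le> length q"
    using arg_min_natI[of "\<lambda>q. awalk u q v" p0 length] arg_min_nat_le[of "\<lambda>q. awalk u q v" _ length]
    by blast
  have cost: "awalk_cost (\<lambda>_. 1) q = real (length q)" for q
    by (induction q) auto
  have "\<mu> (\<lambda>_. 1) u v = ereal (real (length p))"
    unfolding \<mu>_def cost using p by (intro antisym INF_lower2[of p] INF_greatest) auto
  then have "gdist G u v = real (length p)" by (simp add: gdist_def)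
  with p show ?thesis using that by blast
qed

lemma gdist_le_length:
  assumes "awalk u p v"
  shows "gdist G u v \<le> real (length p)"
proof -
  have "u \<in> verts G" "v \<in> verts G" using assms by auto
  then show ?thesis by (rule gdist_awalk) (simp add: assms)
qed

lemma gdist_Nats: "u \<in> verts G \<Longrightarrow> v \<in> verts G \<Longrightarrow> gdist G u v \<in> \<nat>"
  by (rule gdist_awalk[of u v]) simp_all

lemma gdist_self: "u \<in> verts G \<Longrightarrow> gdist G u u = 0"
  by (rule gdist_awalk[of u u]) (use gdist_le_length[of u "[]" u] in \<open>auto simp: awalk_Nil_iff\<close>)

lemma gdist_commute:
  assumes "u \<in> verts G" "v \<in> verts G"
  shows "gdist G u v = gdist G v u"
proof -
  have "gdist G a b \<le> gdist G b a" if ab: "a \<in> verts G" "b \<in> verts G" for a b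
  proof -
    obtain p where p: "awalk b p a" "gdist G b a = real (length p)"
      by (rule gdist_awalk[OF ab(2,1)]) (rule that)
    obtain q where "awalk a q b" "length q = length p" using awalk_rev[OF p(1)] by blast
    then show ?thesis using gdist_le_length[of a q b] p(2) by simp
  qed
  from this[OF assms] this[OF assms(2,1)] show ?thesis by (rule order_antisym)
qed

lemma gdist_ge_1:
  assumes "u \<in> verts G" "v \<in> verts G" "u \<noteq> v"
  shows "1 \<le> gdist G u v"
proof -
  obtain p where p: "awalk u p v" "gdist G u v = real (length p)"
    by (rule gdist_awalk[OF assms(1,2)]) (rule that)
  with assms show ?thesis by (cases p) (auto simp: awalk_Nil_iff)
qed

lemma gdist_eq_1_iff:
  assumes "u \<in> verts G" "v \<in> verts G" "u \<noteq> v"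
  shows "gdist G u v = 1 \<longleftrightarrow> u \<rightarrow> v"
proof
  assume d: "gdist G u v = 1"
  obtain p where p: "awalk u p v" "gdist G u v = real (length p)"
    by (rule gdist_awalk[OF assms(1,2)]) (rule that)
  then obtain e where "p = [e]" using d by (auto simp: length_Suc_conv)
  with p show "u \<rightarrow> v" by (auto simp: awalk_simps arcs_ends_conv)
next
  assume "u \<rightarrow> v"
  then obtain e where "e \<in> arcs G" "tail G e = u" "head G e = v" by auto
  then have "awalk u [e] v" by (auto simp: awalk_simps)
  then show "gdist G u v = 1"
    using gdist_le_length[of u "[e]" v] gdist_ge_1[OF assms] by simp
qed

lemma gdist_common_neighbour:
  assumes "u \<rightarrow> v" "v \<rightarrow> w" "u \<noteq> w" "\<not> u \<rightarrow> w"
  shows "gdist G u w = 2"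
proof -
  have V: "u \<in> verts G" "w \<in> verts G" using assms adj_in_verts by blast+
  obtain e f where "e \<in> arcs G" "tail G e = u" "head G e = v" "f \<in> arcs G" "tail G f = v" "head G f = w"
    using assms(1,2) by (meson reachableE)
  then have "awalk u [e, f] w" by (auto simp: awalk_simps)
  then have le: "gdist G u w \<le> 2" using gdist_le_length[of u "[e, f]" w] by simp
  have "gdist G u w \<noteq> 1" using gdist_eq_1_iff V assms by blast
  moreover have "1 \<le> gdist G u w" using gdist_ge_1 V assms by blast
  moreover obtain k where "gdist G u w = real k" using gdist_Nats[OF V] by (auto elim: Nats_cases)
  ultimately show ?thesis using le by simp
qed

lemma transmission_Ints: "u \<in> verts G \<Longrightarrow> transmission G u \<in> \<int>"
  unfolding transmission_def by (intro Ints_sum) (meson gdist_Nats Nats_subset_Ints subsetD)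

text \<open>Every unordered pair contributes its integer distance twice; half the sum is the Wiener
  index. The induction runs over subsets \<open>A\<close>, where a new vertex adds a row and an
  equal column.\<close>

lemma sum_transmission_even: "\<exists>k::int. (\<Sum>u\<in>verts G. transmission G u) = 2 * of_int k"
proof -
  have "\<exists>k::int. (\<Sum>u\<in>A. \<Sum>w\<in>A. gdist G u w) = 2 * of_int k" if "A \<subseteq> verts G" for A
    using finite_subset[OF that finite_verts] that
  proof (induction A rule: finite_induct)
    case empty
    show ?case by (intro exI[of _ 0]) simp
  next
    case (insert a A)
    then obtain k :: int where k: "(\<Sum>u\<in>A. \<Sum>w\<in>A. gdist G u w) = 2 * of_int k" by auto
    have "(\<Sum>u\<in>A. gdist G u a) = (\<Sum>w\<in>A. gdist G a w)"
      using insert by (intro sum.cong gdist_commute) auto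
    then have "(\<Sum>u\<in>insert a A. \<Sum>w\<in>insert a A. gdist G u w) = 2 * (of_int k + (\<Sum>w\<in>A. gdist G a w))"
      using insert k by (simp add: sum.distrib gdist_self)
    moreover have "(\<Sum>w\<in>A. gdist G a w) \<in> \<int>"
      using insert by (intro Ints_sum) (meson gdist_Nats Nats_subset_Ints insert_subset subsetD)
    ultimately show ?case by (metis Ints_cases of_int_add)
  qed
  then show ?thesis unfolding transmission_def by blast
qed

lemma transmission_le_max: "u \<in> verts G \<Longrightarrow> transmission G u \<le> max_transmission G"
  by (simp add: max_transmission_def)

lemma verts_nonempty: "verts G \<noteq> {}"
  using connected by (auto simp: connected_def strongly_connected_def)

lemma max_transmission_attained: "\<exists>u\<in>verts G. transmission G u = max_transmission G"
  using Max_in[of "transmission G ` verts G"] verts_nonempty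
  by (simp add: max_transmission_def image_iff) metis

text \<open>On two vertices both transmissions equal the only distance. The bound supplies the third
  vertex that \<open>energy_two_vertices\<close> asks for.\<close>

lemma card_verts_ge_3:
  assumes "\<not> transmission_regular G"
  shows "3 \<le> card (verts G)"
proof (rule ccontr)
  assume "\<not> 3 \<le> card (verts G)"
  obtain a b where ab: "a \<in> verts G" "b \<in> verts G" "transmission G a \<noteq> transmission G b"
    using assms by (auto simp: transmission_regular_def)
  then have ne: "a \<noteq> b" by auto
  then have "verts G = {a, b}"
    using card_seteq[of "verts G" "{a, b}"] ab \<open>\<not> 3 \<le> card (verts G)\<close> by auto
  then have "transmission G a = transmission G b"
    using ne ab gdist_commute[of a b] by (simp add: transmission_def gdist_self)
  with ab show False by simp
qed

section \<open>Eigenvalues of the generalized distance matrix\<close>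

lemma gen_distance_matrix_carrier:
  "gen_distance_matrix \<alpha> G vs \<in> carrier_mat (length vs) (length vs)"
  by (simp add: gen_distance_matrix_def transmission_matrix_def distance_matrix_def mat_diag_def)

lemma gen_distance_matrix_index:
  assumes "i < length vs" "j < length vs"
  shows "gen_distance_matrix \<alpha> G vs $$ (i, j) =
    (if i = j then \<alpha> * transmission G (vs ! j) else 0) + (1 - \<alpha>) * gdist G (vs ! i) (vs ! j)"
  using assms
  by (simp add: gen_distance_matrix_def transmission_matrix_def distance_matrix_def mat_diag_def)

text \<open>Passes from coordinate vectors to functions on the vertices, so that the enumeration
  \<open>vs\<close> disappears from the eigenvalue equations.\<close>

lemma mem_spectrum_iff:
  assumes vs: "distinct vs" "set vs = verts G"
  shows "k \<in> spectrum (gen_distance_matrix \<alpha> G vs) \<longleftrightarrow>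
    (\<exists>x. (\<exists>u\<in>verts G. x u \<noteq> 0) \<and> (\<forall>u\<in>verts G.
      \<alpha> * transmission G u * x u + (1 - \<alpha>) * (\<Sum>w\<in>verts G. gdist G u w * x w) = k * x u))"
    (is "_ \<longleftrightarrow> (\<exists>x. ?P x)")
proof -
  let ?M = "gen_distance_matrix \<alpha> G vs" and ?n = "length vs"
  have bij: "bij_betw ((!) vs) {..<?n} (verts G)"
    using bij_betw_nth[OF vs(1) refl] vs(2) by simp
  have verts: "(\<forall>u\<in>verts G. Q u) \<longleftrightarrow> (\<forall>i<?n. Q (vs ! i))" for Q
    unfolding vs(2)[symmetric] by (simp add: all_set_conv_all_nth)
  have eigen: "eigenvector ?M v k \<longleftrightarrow> ?P x"
    if v: "v \<in> carrier_vec ?n" "\<And>i. i < ?n \<Longrightarrow> v $ i = x (vs ! i)" for v x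
  proof -
    have row: "(?M *\<^sub>v v) $ i = \<alpha> * transmission G (vs ! i) * x (vs ! i)
        + (1 - \<alpha>) * (\<Sum>w\<in>verts G. gdist G (vs ! i) w * x w)" if i: "i < ?n" for i
    proof -
      have "(?M *\<^sub>v v) $ i = (\<Sum>j<?n. ?M $$ (i, j) * v $ j)"
        using i v(1) gen_distance_matrix_carrier[of \<alpha> vs] by (simp add: scalar_prod_def atLeast0LessThan)
      also have "\<dots> = (\<Sum>j<?n. (if i = j then \<alpha> * transmission G (vs ! j) * x (vs ! j) else 0)
          + (1 - \<alpha>) * (gdist G (vs ! i) (vs ! j) * x (vs ! j)))"
        using i v(2) by (intro sum.cong) (auto simp: gen_distance_matrix_index algebra_simps)
      also have "\<dots> = \<alpha> * transmission G (vs ! i) * x (vs ! i)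
          + (1 - \<alpha>) * (\<Sum>j<?n. gdist G (vs ! i) (vs ! j) * x (vs ! j))"
        using i by (simp add: sum.distrib sum_distrib_left)
      finally show ?thesis
        using sum.reindex_bij_betw[OF bij, of "\<lambda>w. gdist G (vs ! i) w * x w"] by simp
    qed
    have "v \<noteq> 0\<^sub>v ?n \<longleftrightarrow> (\<exists>u\<in>verts G. x u \<noteq> 0)"
      using v verts[of "\<lambda>u. x u = 0"] by (auto simp: vec_eq_iff)
    moreover have "?M *\<^sub>v v = k \<cdot>\<^sub>v v \<longleftrightarrow> (\<forall>i<?n. (?M *\<^sub>v v) $ i = k * x (vs ! i))"
      using v gen_distance_matrix_carrier[of \<alpha> vs] by (auto simp: vec_eq_iff)
    moreover have "\<dots> \<longleftrightarrow> (\<forall>i<?n. \<alpha> * transmission G (vs ! i) * x (vs ! i)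
        + (1 - \<alpha>) * (\<Sum>w\<in>verts G. gdist G (vs ! i) w * x w) = k * x (vs ! i))"
      by (intro iff_allI imp_cong refl) (simp only: row)
    moreover have "dim_row ?M = ?n" using gen_distance_matrix_carrier[of \<alpha> vs] by simp
    ultimately show ?thesis
      using v(1) unfolding eigenvector_def
        verts[of "\<lambda>u. \<alpha> * transmission G u * x u + (1 - \<alpha>) * (\<Sum>w\<in>verts G. gdist G u w * x w) = k * x u"]
      by simp
  qed
  show ?thesis
  proof
    assume "k \<in> spectrum ?M"
    then obtain v where v: "eigenvector ?M v k" by (auto simp: spectrum_def eigenvalue_def)
    then have "v \<in> carrier_vec ?n"
      using gen_distance_matrix_carrier[of \<alpha> vs] by (simp add: eigenvector_def)
    moreover define x where "x u = v $ the_inv_into {..<?n} ((!) vs) u" for u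
    moreover have "v $ i = x (vs ! i)" if "i < ?n" for i
      using bij that by (simp add: x_def the_inv_into_f_f bij_betw_imp_inj_on)
    ultimately have "?P x" using eigen[of v x] v by (simp only:)
    then show "\<exists>x. ?P x" by (intro exI[of _ x])
  next
    assume "\<exists>x. ?P x"
    then obtain x where "?P x" ..
    then have "eigenvector ?M (Matrix.vec ?n (\<lambda>i. x (vs ! i))) k"
      using eigen[of "Matrix.vec ?n (\<lambda>i. x (vs ! i))" x] by simp
    then show "k \<in> spectrum ?M" by (auto simp: spectrum_def eigenvalue_def)
  qed
qed

lemma finite_spectrum: "finite (spectrum (gen_distance_matrix \<alpha> G vs))"
  using card_finite_spectrum(1)[OF gen_distance_matrix_carrier] .

lemma D_spectral_radius_mem:
  assumes vs: "distinct vs" "set vs = verts G"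
  shows "D_spectral_radius \<alpha> G vs \<in> spectrum (gen_distance_matrix \<alpha> G vs)"
proof -
  have "length vs \<noteq> 0" using vs verts_nonempty by auto
  moreover have "gen_distance_matrix \<alpha> G vs $$ (i, j) = gen_distance_matrix \<alpha> G vs $$ (j, i)"
    if "i < length vs" "j < length vs" for i j
  proof -
    have "vs ! i \<in> verts G" "vs ! j \<in> verts G" using that vs(2) nth_mem by blast+
    then have "gdist G (vs ! i) (vs ! j) = gdist G (vs ! j) (vs ! i)" by (rule gdist_commute)
    then show ?thesis using that by (simp only: gen_distance_matrix_index) simp
  qed
  ultimately have "spectrum (gen_distance_matrix \<alpha> G vs) \<noteq> {}"
    by (rule real_symmetric_spectrum_nonempty[OF gen_distance_matrix_carrier])
  then show ?thesis unfolding D_spectral_radius_def by (rule Max_in[OF finite_spectrum])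
qed

text \<open>With \<open>Tr\<close> the diagonal matrix of transmissions and \<open>D\<close> the
  distance matrix, \<open>T - \<alpha> Tr - (1 - \<alpha>) D = (T - Tr) + (1 - \<alpha>) (Tr -
  D)\<close>. Transmissions are the row sums of \<open>D\<close>, so \<open>Tr - D\<close> is the
  Laplacian of the distances. Hence the energy is the form of \<open>T\<close> minus the generalized
  distance matrix, here evaluated at an eigenvector.\<close>

lemma energy_eigenvector:
  assumes x: "\<And>u. u \<in> verts G \<Longrightarrow>
    \<alpha> * transmission G u * x u + (1 - \<alpha>) * (\<Sum>w\<in>verts G. gdist G u w * x w) = k * x u"
  shows "energy (verts G) (1 - \<alpha>) (\<lambda>u. T - transmission G u) (gdist G) x
    = (T - k) * (\<Sum>u\<in>verts G. (x u)\<^sup>2)"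
proof -
  let ?V = "verts G"
  define X where "X = (\<Sum>u\<in>?V. (x u)\<^sup>2)"
  \<comment> \<open>\<open>A\<close> and \<open>B\<close> are the quadratic forms of
    \<open>Tr\<close> and \<open>D\<close> at \<open>x\<close>.\<close>
  define A where "A = (\<Sum>u\<in>?V. transmission G u * (x u)\<^sup>2)"
  define B where "B = (\<Sum>u\<in>?V. x u * (\<Sum>w\<in>?V. gdist G u w * x w))"
  have "\<alpha> * A + (1 - \<alpha>) * B
      = (\<Sum>u\<in>?V. x u * (\<alpha> * transmission G u * x u + (1 - \<alpha>) * (\<Sum>w\<in>?V. gdist G u w * x w)))"
  proof -
    have "\<alpha> * A = (\<Sum>u\<in>?V. x u * (\<alpha> * transmission G u * x u))"
      by (simp add: A_def sum_distrib_left power2_eq_square mult_ac)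
    moreover have "(1 - \<alpha>) * B = (\<Sum>u\<in>?V. x u * ((1 - \<alpha>) * (\<Sum>w\<in>?V. gdist G u w * x w)))"
      unfolding B_def sum_distrib_left[of "1 - \<alpha>" "\<lambda>u. x u * (\<Sum>w\<in>?V. gdist G u w * x w)"]
      by (simp only: mult.left_commute)
    ultimately show ?thesis by (simp only: sum.distrib distrib_left)
  qed
  also have "\<dots> = k * X"
    unfolding X_def sum_distrib_left[of k] by (intro sum.cong refl) (simp only: x, simp add: power2_eq_square)
  finally have k: "\<alpha> * A + (1 - \<alpha>) * B = k * X" .
  have l: "(\<Sum>u\<in>?V. \<Sum>w\<in>?V. gdist G u w * (x u)\<^sup>2) = A"
    by (simp add: A_def transmission_def sum_distrib_right)
  have "(\<Sum>u\<in>?V. \<Sum>w\<in>?V. gdist G u w * (x w)\<^sup>2) = (\<Sum>w\<in>?V. \<Sum>u\<in>?V. gdist G u w * (x w)\<^sup>2)"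
    by (rule sum.swap)
  also have "\<dots> = A"
    unfolding l[symmetric] by (intro sum.cong refl) (simp add: gdist_commute)
  finally have r: "(\<Sum>u\<in>?V. \<Sum>w\<in>?V. gdist G u w * (x w)\<^sup>2) = A" .
  have "(\<Sum>u\<in>?V. \<Sum>w\<in>?V. gdist G u w * (x u - x w)\<^sup>2)
      = (\<Sum>u\<in>?V. \<Sum>w\<in>?V. gdist G u w * (x u)\<^sup>2) + (\<Sum>u\<in>?V. \<Sum>w\<in>?V. gdist G u w * (x w)\<^sup>2) - 2 * B"
    unfolding B_def sum_distrib_left sum.distrib[symmetric] sum_subtractf[symmetric]
    by (intro sum.cong refl) (simp add: power2_eq_square algebra_simps)
  then have dd: "(\<Sum>u\<in>?V. \<Sum>w\<in>?V. gdist G u w * (x u - x w)\<^sup>2) = 2 * A - 2 * B"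
    by (simp add: l r)
  have tt: "(\<Sum>u\<in>?V. (T - transmission G u) * (x u)\<^sup>2) = T * X - A"
    by (simp add: X_def A_def left_diff_distrib sum_subtractf sum_distrib_left)
  show ?thesis
    unfolding energy_def dd tt X_def[symmetric] using k by (simp add: field_simps)
qed

section \<open>Extremal graphs and the eigenvalue they attain\<close>

definition nonneighbours :: "'a \<Rightarrow> 'a set" where
  "nonneighbours u = {w \<in> verts G. w \<noteq> u \<and> \<not> u \<rightarrow> w}"

text \<open>A common form of the two equality cases: \<open>v\<close> is adjacent to all other
  vertices and the complement of \<open>G - v\<close> is \<open>c\<close>-regular. For
  \<open>c = 1\<close> this describes the complete multipartite graph of the first claim, for
  \<open>c = 2\<close> and order at least 4 the DVDR graphs of the second.\<close>

definition extremal :: "nat \<Rightarrow> bool" where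
  "extremal c \<longleftrightarrow> (\<exists>v\<in>verts G. nonneighbours v = {} \<and>
     (\<forall>u\<in>verts G - {v}. card (nonneighbours u) = c))"

text \<open>Two non-adjacent vertices are joined through \<open>v\<close>, so a non-neighbour of
  \<open>u\<close> lies at distance exactly 2 and every other vertex apart from \<open>u\<close> at
  distance 1.\<close>

lemma transmission_dominated:
  assumes v: "v \<in> verts G" "nonneighbours v = {}" and u: "u \<in> verts G"
  shows "transmission G u = real (card (verts G)) - 1 + real (card (nonneighbours u))"
proof -
  have vw: "v \<rightarrow> w" if "w \<in> verts G - {v}" for w using v that by (auto simp: nonneighbours_def)
  have d: "gdist G u w = 1 + of_bool (w \<in> nonneighbours u)" if w: "w \<in> verts G - {u}" for w
  proof (cases "u \<rightarrow> w")
    case True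
    then show ?thesis using gdist_eq_1_iff[of u w] u w by (auto simp: nonneighbours_def)
  next
    case False
    then have "u \<noteq> v" "w \<noteq> v" using u w vw adj_sym by blast+
    then have "gdist G u w = 2"
      using False u w vw by (intro gdist_common_neighbour[of u v w]) (auto intro: adj_sym)
    then show ?thesis using False u w by (auto simp: nonneighbours_def)
  qed
  have "transmission G u = (\<Sum>w\<in>verts G - {u}. gdist G u w)"
    unfolding transmission_def using u by (simp add: sum.remove[OF finite_verts u] gdist_self)
  also have "\<dots> = (\<Sum>w\<in>verts G - {u}. 1 + of_bool (w \<in> nonneighbours u))"
    by (intro sum.cong refl d)
  also have "\<dots> = real (card (verts G - {u})) + real (card ((verts G - {u}) \<inter> nonneighbours u))"
    by (simp add: sum.distrib)
  also have "real (card (verts G - {u})) = real (card (verts G)) - 1"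
    using u card.remove[of "verts G" u] by simp
  also have "(verts G - {u}) \<inter> nonneighbours u = nonneighbours u"
    by (auto simp: nonneighbours_def)
  finally show ?thesis .
qed

lemma finite_nonneighbours [simp]: "finite (nonneighbours u)"
  by (simp add: nonneighbours_def)

text \<open>A vector with one value at \<open>v\<close> and one value elsewhere reduces the
  eigenvalue equations to two: the equation at \<open>v\<close> is the definition of
  \<open>P\<close>, the other one is \<open>key\<close>. Only membership in the spectrum is shown
  here; that the value is the largest follows from the lower bound in
  \<open>spectral_gap\<close>.\<close>

lemma spectrum_extremal:
  assumes vs: "distinct vs" "set vs = verts G" and "\<alpha> < 1" and n: "2 \<le> card (verts G)"
    and c: "0 < c" "extremal c"
  shows "max_transmission G - gap (1 - \<alpha>) (card (verts G)) c \<in> spectrum (gen_distance_matrix \<alpha> G vs)"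
proof -
  define \<beta> m l where "\<beta> = 1 - \<alpha>" and "m = real (card (verts G)) - 1"
    and "l = gap \<beta> (card (verts G)) c"
  define P where "P = c + \<beta> * m - l"
  have \<beta>: "\<beta> > 0" "\<alpha> = 1 - \<beta>" using \<open>\<alpha> < 1\<close> by (auto simp: \<beta>_def)
  have m: "m \<ge> 1" "real (card (verts G)) = m + 1" using n by (auto simp: m_def)
  have l: "l\<^sup>2 - (\<beta> * (m + 1) + c) * l + c * \<beta> = 0" "l < \<beta>" "l < c"
    using gap_quadratic[of \<beta> c "m + 1"] \<beta> c m(1) unfolding l_def m(2) by simp_all
  have key: "\<beta>\<^sup>2 * m = (\<beta> - l) * P"
    using l(1) by (simp add: P_def power2_eq_square algebra_simps)
  obtain v where v: "v \<in> verts G" "nonneighbours v = {}"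
    and nv: "\<And>u. u \<in> verts G - {v} \<Longrightarrow> card (nonneighbours u) = c"
    using c(2) unfolding extremal_def by blast
  have Tv: "transmission G v = m"
    using transmission_dominated[OF v v(1)] v m(2) by simp
  have Tu: "transmission G u = m + c" if "u \<in> verts G - {v}" for u
    using transmission_dominated[OF v, of u] nv[OF that] that m(2) by simp
  have "card (verts G - {v}) \<noteq> 0" using v n by simp
  then obtain w where w: "w \<in> verts G - {v}" by (metis card.empty ex_in_conv)
  have "max_transmission G = m + c"
    unfolding max_transmission_def
  proof (rule Max_eqI)
    show "y \<le> m + c" if "y \<in> transmission G ` verts G" for y
      using that Tu Tv by (cases "y = m") force+
    show "m + c \<in> transmission G ` verts G" using w Tu[OF w] by (metis DiffD1 imageI)
  qed simp
  then have T: "max_transmission G - l = m + c - l" by simp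
  \<comment> \<open>This vector annihilates both squares in \<open>energy_complete_graph\<close> and
    is scaled to have the value \<open>P\<close> off \<open>v\<close>.\<close>
  define x where "x u = (if u = v then \<beta> * m else P)" for u
  have dv: "gdist G u v = 1" if "u \<in> verts G - {v}" for u
  proof -
    have "v \<rightarrow> u" using v that by (auto simp: nonneighbours_def)
    then show ?thesis using gdist_eq_1_iff[of u v] that v adj_sym by auto
  qed
  \<comment> \<open>A constant plus a correction at \<open>v\<close>: in each row sum the constant
    yields a multiple of the transmission and the correction a single distance.\<close>
  have x: "x u = P + (if u = v then \<beta> * m - P else 0)" for u by (simp add: x_def)
  have sum: "(\<Sum>w\<in>verts G. gdist G u w * x w) = P * transmission G u + (\<beta> * m - P) * gdist G u v" for u
    unfolding x transmission_def sum_distrib_left using v(1)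
    by (simp add: distrib_left sum.distrib if_distrib[of "times _"] mult_ac cong: if_cong)
  have "\<alpha> * transmission G u * x u + (1 - \<alpha>) * (\<Sum>w\<in>verts G. gdist G u w * x w)
      = (m + c - l) * x u" if "u \<in> verts G" for u
  proof (cases "u = v")
    case True
    then show ?thesis
      unfolding sum \<beta>(2) using that by (simp add: Tv gdist_self x_def P_def algebra_simps)
  next
    case False
    then have u: "u \<in> verts G - {v}" using that by simp
    have "(1 - \<beta>) * (m + c) * P + \<beta> * (P * (m + c) + (\<beta> * m - P)) = (m + c) * P + (\<beta>\<^sup>2 * m - \<beta> * P)"
      by (simp add: power2_eq_square algebra_simps)
    also have "\<dots> = (m + c - l) * P" unfolding key by (simp add: algebra_simps)
    finally show ?thesis
      unfolding sum \<beta>(2) using False by (simp add: Tu[OF u] dv[OF u] x_def)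
  qed
  moreover have "x v \<noteq> 0" using \<beta> m by (simp add: x_def)
  ultimately have "m + c - l \<in> spectrum (gen_distance_matrix \<alpha> G vs)"
    unfolding mem_spectrum_iff[OF vs] using v(1) by (intro exI[of _ x]) auto
  then show ?thesis using T by (simp add: l_def \<beta>_def)
qed

lemma spectral_radius_energy:
  assumes vs: "distinct vs" "set vs = verts G"
  obtains x where "\<exists>u\<in>verts G. x u \<noteq> 0" "(\<Sum>u\<in>verts G. (x u)\<^sup>2) > 0"
    "energy (verts G) (1 - \<alpha>) (\<lambda>u. max_transmission G - transmission G u) (gdist G) x
      = (max_transmission G - D_spectral_radius \<alpha> G vs) * (\<Sum>u\<in>verts G. (x u)\<^sup>2)"
proof -
  obtain x where x: "\<exists>u\<in>verts G. x u \<noteq> 0"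
    "\<And>u. u \<in> verts G \<Longrightarrow> \<alpha> * transmission G u * x u + (1 - \<alpha>) * (\<Sum>w\<in>verts G. gdist G u w * x w)
      = D_spectral_radius \<alpha> G vs * x u"
    using D_spectral_radius_mem[OF vs, of \<alpha>] unfolding mem_spectrum_iff[OF vs] by auto
  obtain u where "u \<in> verts G" "x u \<noteq> 0" using x(1) by blast
  then have "(\<Sum>u\<in>verts G. (x u)\<^sup>2) > 0" by (intro sum_pos2[of _ u]) auto
  with x(1) show ?thesis using that energy_eigenvector[OF x(2)] by blast
qed

section \<open>Bounds on the difference of maximum transmission and spectral radius\<close>

text \<open>This is \<open>energy_bound\<close> for the transmission deficits and the distances, at
  an eigenvector for the spectral radius. In the equality case all distances to \<open>v\<close> are
  1, so \<open>v\<close> is adjacent to every other vertex and \<open>transmission_dominated\<close>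
  turns the transmission difference \<open>c\<close> into \<open>c\<close> non-neighbours.\<close>

lemma spectral_gap_one_vertex:
  fixes c :: nat
  assumes vs: "distinct vs" "set vs = verts G" and "\<alpha> < 1" and n: "2 \<le> card (verts G)" and "0 < c"
    and v: "v \<in> verts G" "c \<le> max_transmission G - transmission G v"
  shows "gap (1 - \<alpha>) (card (verts G)) c \<le> max_transmission G - D_spectral_radius \<alpha> G vs"
    and "max_transmission G - D_spectral_radius \<alpha> G vs = gap (1 - \<alpha>) (card (verts G)) c \<Longrightarrow> extremal c"
proof -
  let ?V = "verts G" and ?T = "max_transmission G"
  obtain x where x: "\<exists>u\<in>?V. x u \<noteq> 0" "(\<Sum>u\<in>?V. (x u)\<^sup>2) > 0"
    "energy ?V (1 - \<alpha>) (\<lambda>u. ?T - transmission G u) (gdist G) x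
      = (?T - D_spectral_radius \<alpha> G vs) * (\<Sum>u\<in>?V. (x u)\<^sup>2)"
    by (rule spectral_radius_energy[OF vs])
  have bounds: "0 < 1 - \<alpha>" "0 < real c" "\<And>u. u \<in> ?V - {v} \<Longrightarrow> 0 \<le> ?T - transmission G u"
    using \<open>\<alpha> < 1\<close> \<open>0 < c\<close> transmission_le_max by auto
  note E = energy_bound[of ?V v "1 - \<alpha>" c "\<lambda>u. ?T - transmission G u" "gdist G" x,
    OF finite_verts v(1) n bounds(1,2) v(2) bounds(3) gdist_ge_1]
  show "gap (1 - \<alpha>) (card ?V) c \<le> ?T - D_spectral_radius \<alpha> G vs"
    using E(1) x(2) unfolding x(3) by simp
  assume eq: "?T - D_spectral_radius \<alpha> G vs = gap (1 - \<alpha>) (card ?V) c"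
  then have Tv: "?T - transmission G v = c"
    and Tu: "\<And>u. u \<in> ?V - {v} \<Longrightarrow> transmission G u = ?T \<and> gdist G u v = 1"
    using E(2) x(1,3) by auto
  have "v \<rightarrow> u" if "u \<in> ?V - {v}" for u
    using Tu[OF that] gdist_eq_1_iff[of u v] that v(1) adj_sym by auto
  then have nv: "nonneighbours v = {}" by (auto simp: nonneighbours_def)
  have "card (nonneighbours u) = c" if u: "u \<in> ?V - {v}" for u
    using transmission_dominated[OF v(1) nv v(1)] transmission_dominated[OF v(1) nv, of u] Tu[OF u] Tv u nv
    by simp
  then show "extremal c" using v(1) nv by (auto simp: extremal_def)
qed

lemma spectral_gap_two_vertices:
  assumes vs: "distinct vs" "set vs = verts G" and "\<alpha> < 1" and n: "3 \<le> card (verts G)"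
    and u: "u \<in> verts G" "1 \<le> max_transmission G - transmission G u"
    and v: "v \<in> verts G" "1 \<le> max_transmission G - transmission G v" and "u \<noteq> v"
  shows "gap (1 - \<alpha>) (card (verts G)) 2 < max_transmission G - D_spectral_radius \<alpha> G vs"
proof -
  let ?V = "verts G" and ?T = "max_transmission G"
  obtain x where x: "\<exists>u\<in>?V. x u \<noteq> 0" "(\<Sum>u\<in>?V. (x u)\<^sup>2) > 0"
    "energy ?V (1 - \<alpha>) (\<lambda>u. ?T - transmission G u) (gdist G) x
      = (?T - D_spectral_radius \<alpha> G vs) * (\<Sum>u\<in>?V. (x u)\<^sup>2)"
    by (rule spectral_radius_energy[OF vs])
  have bounds: "0 < 1 - \<alpha>" "\<And>u. u \<in> ?V \<Longrightarrow> 0 \<le> ?T - transmission G u"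
    using \<open>\<alpha> < 1\<close> transmission_le_max by auto
  show ?thesis
    using energy_two_vertices[of ?V u v "1 - \<alpha>" "\<lambda>u. ?T - transmission G u" "gdist G" x,
        OF finite_verts u(1) v(1) \<open>u \<noteq> v\<close> n bounds(1) u(2) v(2) bounds(2) gdist_ge_1 x(1)]
      x(2) unfolding x(3) by simp
qed

lemma transmission_deficit_ge_1:
  assumes "u \<in> verts G" "transmission G u \<noteq> max_transmission G"
  shows "1 \<le> max_transmission G - transmission G u"
proof -
  obtain w where "w \<in> verts G" "transmission G w = max_transmission G"
    using max_transmission_attained by blast
  then obtain a b :: int where "max_transmission G = of_int a" "transmission G u = of_int b"
    using transmission_Ints assms(1) by (metis Ints_cases)
  with transmission_le_max[OF assms(1)] assms(2) show ?thesis by simp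
qed

text \<open>For even order the deficits add up to an even number, because the transmissions do.\<close>

lemma even_order_deficit:
  assumes "even (card (verts G))" and v: "v \<in> verts G" "transmission G v \<noteq> max_transmission G"
    and "max_transmission G - transmission G v < 2"
  obtains u where "u \<in> verts G" "u \<noteq> v" "transmission G u \<noteq> max_transmission G"
proof -
  obtain w where "w \<in> verts G" "transmission G w = max_transmission G"
    using max_transmission_attained by blast
  then obtain a b :: int where a: "max_transmission G = of_int a" and b: "transmission G v = of_int b"
    using transmission_Ints v(1) by (metis Ints_cases)
  have ab: "a = b + 1" using transmission_deficit_ge_1[OF v] assms(4) unfolding a b by linarith
  obtain k :: int where k: "(\<Sum>u\<in>verts G. transmission G u) = 2 * of_int k"
    using sum_transmission_even by blast
  have "\<exists>u\<in>verts G - {v}. transmission G u \<noteq> max_transmission G"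
  proof (rule ccontr)
    \<comment> \<open>If only \<open>v\<close> were deficient, then for order \<open>n\<close> the
      transmissions would add up to \<open>(a - 1) + (n - 1) * a = n * a - 1\<close>, which is odd
      for even \<open>n\<close>.\<close>
    assume "\<not> ?thesis"
    then have "(\<Sum>u\<in>verts G - {v}. transmission G u) = (\<Sum>u\<in>verts G - {v}. of_int a)"
      by (intro sum.cong) (auto simp: a)
    then have "2 * of_int k = of_int b + real (card (verts G - {v})) * of_int a"
      using k unfolding sum.remove[OF finite_verts v(1)] b by simp
    then have "2 * k = b + int (card (verts G - {v})) * a"
      by (metis (mono_tags, opaque_lifting) of_int_add of_int_eq_iff of_int_mult of_int_numeral of_int_of_nat_eq)
    moreover have "card (verts G) = Suc (card (verts G - {v}))"
      using v(1) card.remove[of "verts G" v] by simp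
    ultimately show False using assms(1) ab by (metis dvd_triv_left even_add even_mult_iff even_of_nat even_Suc odd_one)
  qed
  then show ?thesis using that by blast
qed

text \<open>A deficient vertex of deficit at least \<open>c\<close> is handled by
  \<open>spectral_gap_one_vertex\<close>. Otherwise integrality leaves only \<open>c = 2\<close>
  with deficit 1, and a second deficient vertex makes the bound strict. Conversely, on an extremal
  graph the eigenvalue of \<open>spectrum_extremal\<close> bounds the difference from above by the
  same number.\<close>

lemma spectral_gap:
  fixes c :: nat
  assumes vs: "distinct vs" "set vs = verts G" and "\<alpha> < 1" and nonreg: "\<not> transmission_regular G"
    and c_def: "c = (if odd (card (verts G)) then 1 else 2)"
  shows "gap (1 - \<alpha>) (card (verts G)) c \<le> max_transmission G - D_spectral_radius \<alpha> G vs"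
    and "max_transmission G - D_spectral_radius \<alpha> G vs = gap (1 - \<alpha>) (card (verts G)) c \<longleftrightarrow> extremal c"
proof -
  let ?g = "gap (1 - \<alpha>) (card (verts G)) c"
    and ?d = "max_transmission G - D_spectral_radius \<alpha> G vs"
  have n: "3 \<le> card (verts G)" using card_verts_ge_3[OF nonreg] .
  then have n2: "2 \<le> card (verts G)" and c: "0 < c" by (simp_all add: c_def)
  obtain v where v: "v \<in> verts G" "transmission G v \<noteq> max_transmission G"
    using nonreg unfolding transmission_regular_def by metis
  have *: "?g \<le> ?d \<and> (?d = ?g \<longrightarrow> extremal c)"
  proof (cases "c \<le> max_transmission G - transmission G v")
    case True
    then show ?thesis using spectral_gap_one_vertex[OF vs \<open>\<alpha> < 1\<close> n2 c v(1)] by blast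
  next
    case False
    then have "c = 2" using transmission_deficit_ge_1[OF v] by (auto simp: c_def split: if_splits)
    then have "even (card (verts G))" by (simp add: c_def split: if_splits)
    moreover have "max_transmission G - transmission G v < 2" using False \<open>c = 2\<close> by simp
    ultimately obtain u where "u \<in> verts G" "u \<noteq> v" "transmission G u \<noteq> max_transmission G"
      using v by (rule_tac even_order_deficit)
    then have "gap (1 - \<alpha>) (card (verts G)) 2 < ?d"
      using spectral_gap_two_vertices[OF vs \<open>\<alpha> < 1\<close> n] v transmission_deficit_ge_1 by blast
    then show ?thesis using \<open>c = 2\<close> by simp
  qed
  then show "?g \<le> ?d" by blast
  show "?d = ?g \<longleftrightarrow> extremal c"
  proof
    assume "extremal c"
    then have "max_transmission G - ?g \<le> D_spectral_radius \<alpha> G vs"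
      unfolding D_spectral_radius_def
      using spectrum_extremal[OF vs \<open>\<alpha> < 1\<close> n2 c] by (intro Max_ge finite_spectrum)
    with * show "?d = ?g" by simp
  qed (use * in blast)
qed

section \<open>Identification of the extremal graphs\<close>

lemma out_degree_nonneighbours:
  assumes "u \<in> verts G"
  shows "out_degree G u + card (nonneighbours u) + 1 = card (verts G)"
proof -
  have "inj_on (head G) (out_arcs G u)"
    by (rule inj_onI) (auto intro!: no_multi_arcs simp: arc_to_ends_def)
  then have "out_degree G u = card (head G ` out_arcs G u)"
    by (simp add: out_degree_def card_image)
  also have "head G ` out_arcs G u = {w. u \<rightarrow> w}" by (force simp: arcs_ends_conv)
  finally have "out_degree G u = card {w. u \<rightarrow> w}" .
  moreover have "verts G = insert u ({w. u \<rightarrow> w} \<union> nonneighbours u)"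
    using assms adj_in_verts by (auto simp: nonneighbours_def)
  moreover have "finite {w. u \<rightarrow> w}" using adj_in_verts by (auto intro: finite_subset[OF _ finite_verts])
  moreover have "{w. u \<rightarrow> w} \<inter> nonneighbours u = {}" "u \<notin> {w. u \<rightarrow> w} \<union> nonneighbours u"
    using adj_not_same by (auto simp: nonneighbours_def)
  ultimately show ?thesis by (simp add: card_Un_disjoint)
qed

lemma out_degree_del_vert:
  assumes "u \<noteq> v" "u \<rightarrow> v"
  shows "out_degree (del_vert v) u + 1 = out_degree G u"
proof -
  obtain a where a: "a \<in> arcs G" "tail G a = u" "head G a = v" using assms(2) by auto
  have "out_arcs (del_vert v) u = out_arcs G u - {a}"
    using a assms(1) by (auto simp: out_arcs_def del_vert_simps intro!: no_multi_arcs simp: arc_to_ends_def)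
  moreover have "card (out_arcs G u) = Suc (card (out_arcs G u - {a}))"
    using a by (intro card.remove) auto
  ultimately show ?thesis by (simp only: out_degree_def)
qed

text \<open>For order \<open>n\<close>, a vertex with two non-neighbours has degree
  \<open>n - 3\<close> and loses one arc when \<open>v\<close> is deleted. The bound on the order
  keeps \<open>n - 4\<close> from being truncated: the path on three vertices satisfies only the
  right-hand side.\<close>

lemma extremal_2_iff_DVDR:
  assumes n: "4 \<le> card (verts G)"
  shows "extremal 2 \<longleftrightarrow> DVDR (card (verts G) - 4) G"
proof -
  have dominating: "out_degree G v = card (verts G) - 1 \<longleftrightarrow> nonneighbours v = {}" if "v \<in> verts G" for v
  proof -
    have "nonneighbours v = {} \<longleftrightarrow> card (nonneighbours v) = 0" by simp
    then show ?thesis using out_degree_nonneighbours[OF that] by linarith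
  qed
  have *: "card (nonneighbours u) = 2 \<longleftrightarrow> out_degree (del_vert v) u = card (verts G) - 4"
    if v: "v \<in> verts G" "nonneighbours v = {}" and u: "u \<in> verts G - {v}" for u v
  proof -
    have "u \<rightarrow> v" using v u adj_sym by (auto simp: nonneighbours_def)
    then show ?thesis
      using out_degree_del_vert[of u v] out_degree_nonneighbours[of u] u n by auto
  qed
  have "extremal 2 \<longleftrightarrow> (\<exists>v\<in>verts G. nonneighbours v = {} \<and>
      (\<forall>u\<in>verts G - {v}. out_degree (del_vert v) u = card (verts G) - 4))"
    unfolding extremal_def by (intro bex_cong conj_cong ball_cong refl) (rule *)
  then show ?thesis
    by (simp add: DVDR_def regular_graph_def del_vert_simps connected graph_axioms dominating[simplified]
        cong: bex_cong_simp)
qed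

text \<open>Neither graph has parallel arcs, so an isomorphism is determined by its vertex map and
  arcs need no separate treatment afterwards.\<close>

lemma digraph_iso_complete_multipartite_iff:
  "digraph_iso G (complete_multipartite ps) \<longleftrightarrow>
    (\<exists>f. bij_betw f (verts G) (SIGMA i:{..<length ps}. {..<ps ! i}) \<and>
      (\<forall>u\<in>verts G. \<forall>w\<in>verts G. u \<rightarrow> w \<longleftrightarrow> fst (f u) \<noteq> fst (f w)))"
    (is "_ \<longleftrightarrow> (\<exists>f. bij_betw f _ ?W \<and> ?adj f)")
proof
  have K: "verts (complete_multipartite ps) = ?W"
    "arcs (complete_multipartite ps) = {(x, y). x \<in> ?W \<and> y \<in> ?W \<and> fst x \<noteq> fst y}"
    "tail (complete_multipartite ps) = fst" "head (complete_multipartite ps) = snd"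
    by (simp_all add: complete_multipartite_def Let_def)
  {
    assume "digraph_iso G (complete_multipartite ps)"
    then obtain h where h: "digraph_isomorphism h" and K_eq: "complete_multipartite ps = app_iso h G"
      by (auto simp: digraph_iso_def)
    let ?f = "iso_verts h"
    have inj: "inj_on ?f (verts G)" using h by (rule digraph_isomorphism_inj_on_verts)
    have W: "?W = ?f ` verts G" using K(1) by (simp add: K_eq)
    have A: "{(x, y). x \<in> ?W \<and> y \<in> ?W \<and> fst x \<noteq> fst y} = iso_arcs h ` arcs G"
      using K(2) by (simp add: K_eq)
    \<comment> \<open>Equality of records makes the end maps of the image the pair projections, so
      an arc goes to the pair of images of its ends.\<close>
    have ht: "iso_tail h = fst" "iso_head h = snd" using K(3,4) by (simp_all add: K_eq)
    have arc: "iso_arcs h e = (?f (tail G e), ?f (head G e))" if "e \<in> arcs G" for e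
      using iso_verts_tail[OF h that] iso_verts_head[OF h that] by (simp add: ht prod_eq_iff)
    have "u \<rightarrow> w \<longleftrightarrow> fst (?f u) \<noteq> fst (?f w)" if uw: "u \<in> verts G" "w \<in> verts G" for u w
    proof
      assume "u \<rightarrow> w"
      then obtain e where e: "e \<in> arcs G" "tail G e = u" "head G e = w" by auto
      then have "(?f u, ?f w) \<in> {(x, y). x \<in> ?W \<and> y \<in> ?W \<and> fst x \<noteq> fst y}"
        unfolding A using arc[OF e(1)] by (metis imageI)
      then show "fst (?f u) \<noteq> fst (?f w)" by simp
    next
      assume "fst (?f u) \<noteq> fst (?f w)"
      then have "(?f u, ?f w) \<in> iso_arcs h ` arcs G"
        unfolding A[symmetric] unfolding W using uw by simp
      then obtain e where e: "e \<in> arcs G" "?f (tail G e) = ?f u" "?f (head G e) = ?f w"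
        using arc by auto
      then have "tail G e = u" "head G e = w" using inj uw by (auto dest: inj_onD)
      then show "u \<rightarrow> w" using e(1) by (auto simp: arcs_ends_conv)
    qed
    then show "\<exists>f. bij_betw f (verts G) ?W \<and> ?adj f"
      using inj W by (intro exI[of _ ?f]) (simp add: bij_betw_def)
  }
  assume "\<exists>f. bij_betw f (verts G) ?W \<and> ?adj f"
  then obtain f where inj: "inj_on f (verts G)" and W: "f ` verts G = ?W" and adj: "?adj f"
    by (auto simp: bij_betw_def)
  \<comment> \<open>The arcs of the target are pairs of vertices, so the vertex map dictates the arc
    map. The latter is injective because \<open>G\<close> has no parallel arcs.\<close>
  define h where "h = \<lparr>iso_verts = f, iso_arcs = (\<lambda>e. (f (tail G e), f (head G e))),
    iso_head = snd, iso_tail = fst\<rparr>"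
  have "inj_on (\<lambda>e. (f (tail G e), f (head G e))) (arcs G)"
    using inj by (intro inj_onI no_multi_arcs) (auto simp: arc_to_ends_def dest: inj_onD)
  then have "digraph_isomorphism h"
    using inj wf_digraph by (simp add: h_def digraph_isomorphism_def)
  moreover have "complete_multipartite ps = app_iso h G"
  proof (rule pre_digraph.equality)
    show "arcs (complete_multipartite ps) = arcs (app_iso h G)"
      unfolding K
    proof (intro equalityI subsetI)
      fix p assume "p \<in> {(x, y). x \<in> ?W \<and> y \<in> ?W \<and> fst x \<noteq> fst y}"
      then obtain u w where "p = (f u, f w)" "u \<in> verts G" "w \<in> verts G" "fst (f u) \<noteq> fst (f w)"
        unfolding W[symmetric] by auto
      moreover from this obtain e where "e \<in> arcs G" "tail G e = u" "head G e = w"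
        using adj by blast
      ultimately show "p \<in> arcs (app_iso h G)" by (auto simp: h_def)
    next
      fix p assume "p \<in> arcs (app_iso h G)"
      then obtain e where e: "e \<in> arcs G" "p = (f (tail G e), f (head G e))" by (auto simp: h_def)
      then have "tail G e \<rightarrow> head G e" by (auto simp: arcs_ends_conv)
      then show "p \<in> {(x, y). x \<in> ?W \<and> y \<in> ?W \<and> fst x \<noteq> fst y}"
        unfolding W[symmetric] using e adj by auto
    qed
  qed (simp_all add: K h_def W)
  ultimately show "digraph_iso G (complete_multipartite ps)" by (auto simp: digraph_iso_def)
qed

text \<open>\<open>f\<close> carries the non-neighbours of \<open>u\<close> onto the rest of the
  part that contains \<open>f u\<close>.\<close>

lemma card_nonneighbours_multipartite:
  assumes f: "bij_betw f (verts G) (SIGMA i:{..<length ps}. {..<ps ! i})"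
    and adj: "\<forall>u\<in>verts G. \<forall>w\<in>verts G. u \<rightarrow> w \<longleftrightarrow> fst (f u) \<noteq> fst (f w)"
    and u: "u \<in> verts G"
  shows "card (nonneighbours u) = ps ! fst (f u) - 1"
proof -
  let ?W = "SIGMA i:{..<length ps}. {..<ps ! i}"
  have inj: "inj_on f (verts G)" and W: "f ` verts G = ?W" using f by (auto simp: bij_betw_def)
  have fu: "f u \<in> ?W" using u W by blast
  have "f ` nonneighbours u = {p \<in> f ` verts G. fst p = fst (f u)} - {f u}"
    using adj u inj by (auto simp: nonneighbours_def dest: inj_onD)
  also have "\<dots> = {fst (f u)} \<times> {..<ps ! fst (f u)} - {f u}"
    unfolding W using fu by auto
  finally have "f ` nonneighbours u = {fst (f u)} \<times> {..<ps ! fst (f u)} - {f u}" .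
  moreover have "card (f ` nonneighbours u) = card (nonneighbours u)"
    using inj by (intro card_image) (auto intro: inj_on_subset simp: nonneighbours_def)
  moreover have "f u \<in> {fst (f u)} \<times> {..<ps ! fst (f u)}" using fu by (auto simp: mem_Times_iff)
  ultimately show ?thesis by simp
qed

lemma extremal_1_if_multipartite:
  assumes "digraph_iso G (complete_multipartite (1 # replicate k 2))"
  shows "extremal 1"
proof -
  let ?ps = "1 # replicate k 2 :: nat list"
  let ?W = "SIGMA i:{..<length ?ps}. {..<?ps ! i}"
  obtain f where f: "bij_betw f (verts G) ?W"
    and adj: "\<forall>u\<in>verts G. \<forall>w\<in>verts G. u \<rightarrow> w \<longleftrightarrow> fst (f u) \<noteq> fst (f w)"
    using assms unfolding digraph_iso_complete_multipartite_iff by blast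
  note card = card_nonneighbours_multipartite[OF f adj]
  have inj: "inj_on f (verts G)" and W: "f ` verts G = ?W" using f by (auto simp: bij_betw_def)
  have "(0, 0) \<in> ?W" by simp
  \<comment> \<open>Part 0 is the singleton part; its vertex is adjacent to all others.\<close>
  then obtain v where v: "v \<in> verts G" "f v = (0, 0)" unfolding W[symmetric] by force
  have "card (nonneighbours u) = 1" if u: "u \<in> verts G - {v}" for u
  proof -
    have fu: "f u \<in> ?W" "f u \<noteq> (0, 0)"
      using u v W inj_onD[OF inj, of u v] by auto
    then obtain i where "fst (f u) = Suc i" "i < k" by (cases "fst (f u)") (auto simp: Sigma_def)
    then show ?thesis using card[of u] u by simp
  qed
  moreover have "nonneighbours v = {}" using card[OF v(1)] v(2) by simp
  ultimately show ?thesis using v(1) by (auto simp: extremal_def)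
qed

text \<open>Off \<open>v\<close>, non-adjacency of distinct vertices is symmetric and gives every
  vertex exactly one partner. It is thus a perfect matching whose pairs \<open>P u\<close> become
  the parts of size 2. Numbering the pairs by \<open>g\<close> and the members of each pair by
  \<open>h\<close> yields the isomorphism.\<close>

lemma multipartite_if_extremal_1:
  assumes "extremal 1" and n: "card (verts G) = 2 * k + 1"
  shows "digraph_iso G (complete_multipartite (1 # replicate k 2))"
proof -
  let ?ps = "1 # replicate k 2 :: nat list"
  let ?W = "SIGMA i:{..<length ?ps}. {..<?ps ! i}"
  obtain v where v: "v \<in> verts G" "nonneighbours v = {}"
    and one: "\<And>u. u \<in> verts G - {v} \<Longrightarrow> card (nonneighbours u) = 1"
    using assms(1) unfolding extremal_def by blast
  define U where "U = verts G - {v}"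
  define P where "P u = insert u (nonneighbours u)" for u
  have vadj: "v \<rightarrow> u" "u \<rightarrow> v" if "u \<in> U" for u
    using v that adj_commute by (auto simp: nonneighbours_def U_def)
  have PU: "P u \<subseteq> U" if "u \<in> U" for u
    using that vadj by (auto simp: P_def U_def nonneighbours_def)
  have P_mem: "u \<in> P u" for u by (simp add: P_def)
  have P_eq: "P w = P u" if "u \<in> U" "w \<in> P u" for u w
  proof (cases "w = u")
    case False
    then have w: "w \<in> nonneighbours u" "w \<in> U" using that PU by (auto simp: P_def)
    then have u: "u \<in> nonneighbours w" using that by (auto simp: nonneighbours_def U_def adj_commute)
    have "nonneighbours u = {w}" "nonneighbours w = {u}"
      using one[of u] one[of w] that(1) w u by (auto simp: U_def card_1_singleton_iff)
    then show ?thesis by (auto simp: P_def)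
  qed simp
  have P_card: "card (P u) = 2" if "u \<in> U" for u
    using one[of u] that by (simp add: P_def U_def) (simp add: nonneighbours_def)
  have adj: "u \<rightarrow> w \<longleftrightarrow> P u \<noteq> P w" if uw: "u \<in> U" "w \<in> U" for u w
  proof
    assume "u \<rightarrow> w"
    then have "w \<notin> P u" using adj_not_same by (auto simp: P_def nonneighbours_def)
    then show "P u \<noteq> P w" using P_mem by blast
  next
    assume "P u \<noteq> P w"
    then have "w \<notin> P u" using P_eq[OF uw(1)] by blast
    then show "u \<rightarrow> w" using uw by (auto simp: P_def nonneighbours_def U_def)
  qed
  define C where "C = P ` U"
  have finU: "finite U" by (simp add: U_def)
  \<comment> \<open>The disjoint pairs cover \<open>2 * k\<close> vertices, so there are
    \<open>k\<close> of them, as many as parts of size 2.\<close>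
  have "2 * card C = card (\<Union> C)"
  proof (rule card_partition)
    show "finite C" "finite (\<Union> C)" using finU by (auto simp: C_def P_def)
    show "card c = 2" if "c \<in> C" for c using that P_card by (auto simp: C_def)
    show "c1 \<inter> c2 = {}" if c: "c1 \<in> C" "c2 \<in> C" "c1 \<noteq> c2" for c1 c2
    proof (rule ccontr)
      assume "c1 \<inter> c2 \<noteq> {}"
      then obtain w where "w \<in> c1" "w \<in> c2" by blast
      then have "P w = c1" "P w = c2" using c P_eq by (auto simp: C_def)
      with c(3) show False by simp
    qed
  qed
  also have "\<Union> C = U" using PU P_mem by (auto simp: C_def)
  also have "card U = 2 * k" using v(1) n by (simp add: U_def)
  finally have "card C = k" by simp
  then obtain g where g: "bij_betw g C {..<k}"
    using ex_bij_betw_finite_nat[of C] finU by (auto simp: C_def atLeast0LessThan)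
  have "\<forall>p\<in>C. \<exists>h. bij_betw h p {..<2::nat}"
  proof
    fix p assume "p \<in> C"
    then have "card p = 2" using P_card by (auto simp: C_def)
    then show "\<exists>h. bij_betw h p {..<2::nat}"
      using ex_bij_betw_finite_nat[of p] by (metis atLeast0LessThan card.infinite zero_neq_numeral)
  qed
  then obtain h where h: "\<And>p. p \<in> C \<Longrightarrow> bij_betw (h p) p {..<2::nat}" by metis
  \<comment> \<open>Index 0 is reserved for the singleton part holding \<open>v\<close>, hence the
    shift by \<open>Suc\<close>.\<close>
  define f where "f u = (if u = v then (0, 0) else (Suc (g (P u)), h (P u) u))" for u
  have PC: "P u \<in> C" if "u \<in> U" for u using that by (simp add: C_def)
  have g_eq: "g (P u) = g (P w) \<longleftrightarrow> P u = P w" if "u \<in> U" "w \<in> U" for u w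
    using g PC that by (auto simp: bij_betw_def dest: inj_onD)
  have vU: "verts G = insert v U" "v \<notin> U" using v(1) by (auto simp: U_def)
  have fU: "f u = (Suc (g (P u)), h (P u) u)" if "u \<in> U" for u
    using that vU by (auto simp: f_def)
  have fv: "f v = (0, 0)" by (simp add: f_def)
  have "inj_on f U"
  proof (rule inj_onI)
    fix u w assume uw: "u \<in> U" "w \<in> U" "f u = f w"
    then have "P u = P w" "h (P u) u = h (P u) w" using g_eq by (auto simp: fU)
    then show "u = w" using h[OF PC[OF uw(1)]] P_mem[of u] P_mem[of w]
      by (auto simp: bij_betw_def dest: inj_onD)
  qed
  then have inj: "inj_on f (verts G)" unfolding vU(1) using vU(2) fU fv by auto
  have "f ` U = {1..k} \<times> {..<2}"
  proof (intro equalityI subsetI)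
    fix p assume "p \<in> f ` U"
    then obtain u where u: "u \<in> U" "p = (Suc (g (P u)), h (P u) u)" using fU by auto
    have "g (P u) < k" "h (P u) u < 2"
      using g h[OF PC[OF u(1)]] PC[OF u(1)] P_mem[of u] by (auto simp: bij_betw_def)
    then show "p \<in> {1..k} \<times> {..<2}" using u(2) by simp
  next
    fix p :: "nat \<times> nat" assume "p \<in> {1..k} \<times> {..<2}"
    then obtain i j where p: "p = (Suc i, j)" "i < k" "j < 2"
      by (cases p; cases "fst p") auto
    then obtain c where c: "c \<in> C" "g c = i" using g by (metis bij_betw_def imageE lessThan_iff)
    then obtain w where w: "w \<in> c" "h c w = j" using h[OF c(1)] p(3)
      by (metis bij_betw_def imageE lessThan_iff)
    obtain u where u: "u \<in> U" "c = P u" using c(1) by (auto simp: C_def)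
    have "w \<in> U" using u w PU by blast
    moreover have "P w = c" using P_eq[OF u(1)] u(2) w(1) by simp
    ultimately have "f w = p" using fU[of w] c(2) w(2) p(1) by simp
    with \<open>w \<in> U\<close> show "p \<in> f ` U" by blast
  qed
  moreover have "?W = insert (0, 0) ({1..k} \<times> {..<2})"
  proof (rule Set.set_eqI)
    fix p :: "nat \<times> nat"
    show "p \<in> ?W \<longleftrightarrow> p \<in> insert (0, 0) ({1..k} \<times> {..<2})"
    proof (cases p)
      case (Pair i j)
      then show ?thesis by (cases i) (simp_all add: Suc_le_eq cong: conj_cong)
    qed
  qed
  ultimately have "f ` verts G = ?W" unfolding vU(1) using fv by simp
  with inj have "bij_betw f (verts G) ?W" by (simp add: bij_betw_def)
  moreover have "u \<rightarrow> w \<longleftrightarrow> fst (f u) \<noteq> fst (f w)" if "u \<in> verts G" "w \<in> verts G" for u w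
  proof (cases "u = v \<or> w = v")
    case True
    then show ?thesis using that unfolding vU(1) by (auto simp: fU fv vadj dest: adj_not_same)
  next
    case False
    then have "u \<in> U" "w \<in> U" using that by (simp_all add: U_def)
    then show ?thesis using adj[of u w] g_eq[of u w] by (simp add: fU)
  qed
  ultimately show ?thesis unfolding digraph_iso_complete_multipartite_iff by blast
qed

end

theorem theorem1p1:
  fixes G :: "('a, 'b) pre_digraph" and vs :: "'a list" and n :: nat and \<alpha> :: real
  assumes "graph G" and "Digraph_Component.connected G"
    and "card (verts G) = n"
    and "distinct vs" and "set vs = verts G"
    and "\<not> transmission_regular G"
    and "0 \<le> \<alpha>" and "\<alpha> < 1"
  shows "(odd n \<longrightarrow>
            max_transmission G - D_spectral_radius \<alpha> G vs
              \<ge> ((1 - \<alpha>) * real n + 1 - sqrt (((1 - \<alpha>) * real n + 1)\<^sup>2 - 4 * (1 - \<alpha>))) / 2 \<and>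
            (max_transmission G - D_spectral_radius \<alpha> G vs
              = ((1 - \<alpha>) * real n + 1 - sqrt (((1 - \<alpha>) * real n + 1)\<^sup>2 - 4 * (1 - \<alpha>))) / 2
             \<longleftrightarrow> digraph_iso G (complete_multipartite (1 # replicate ((n - 1) div 2) 2)))) \<and>
         (even n \<longrightarrow>
            max_transmission G - D_spectral_radius \<alpha> G vs
              \<ge> ((1 - \<alpha>) * real n + 2 - sqrt (((1 - \<alpha>) * real n + 2)\<^sup>2 - 8 * (1 - \<alpha>))) / 2 \<and>
            (max_transmission G - D_spectral_radius \<alpha> G vs
              = ((1 - \<alpha>) * real n + 2 - sqrt (((1 - \<alpha>) * real n + 2)\<^sup>2 - 8 * (1 - \<alpha>))) / 2
             \<longleftrightarrow> DVDR (n - 4) G))"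
proof -
  interpret connected_graph G
    using assms(1,2) by (simp add: connected_graph_def connected_graph_axioms_def)
  note gap = spectral_gap[OF assms(4,5,8,6), unfolded assms(3)]
  have "3 \<le> n" using card_verts_ge_3[OF assms(6)] assms(3) by simp
  have g1: "((1 - \<alpha>) * real n + 1 - sqrt (((1 - \<alpha>) * real n + 1)\<^sup>2 - 4 * (1 - \<alpha>))) / 2
      = gap (1 - \<alpha>) n (real 1)"
    by (simp add: gap_def)
  have g2: "((1 - \<alpha>) * real n + 2 - sqrt (((1 - \<alpha>) * real n + 2)\<^sup>2 - 8 * (1 - \<alpha>))) / 2
      = gap (1 - \<alpha>) n (real 2)"
    by (simp add: gap_def)
  have "extremal 1 \<longleftrightarrow> digraph_iso G (complete_multipartite (1 # replicate ((n - 1) div 2) 2))"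
    if odd: "odd n"
  proof -
    obtain k where k: "n = 2 * k + 1" using odd by (elim oddE)
    then show ?thesis
      using extremal_1_if_multipartite[of k] multipartite_if_extremal_1[of k] assms(3) by auto
  qed
  moreover have "extremal 2 \<longleftrightarrow> DVDR (n - 4) G" if "even n"
  proof -
    \<comment> \<open>Even order excludes 3, so \<open>n\<close> is at least 4, as
      \<open>extremal_2_iff_DVDR\<close> demands.\<close>
    have "n \<noteq> 3" using that by auto
    then show ?thesis using extremal_2_iff_DVDR \<open>3 \<le> n\<close> unfolding assms(3) by simp
  qed
  ultimately show ?thesis
    unfolding g1 g2 using gap[of 1] gap[of 2] by (cases "odd n") simp_all
qed

end
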